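(* Let $E$ be a finite set, let $(E,\mathcal{F})$ be a $k$-truncated antimatroid of rank $k$, let $\mathcal{F}_{k-1}=\{X\in\mathcal{F}:|X|\le k-1\}$, let $\pi:E\times 2^E\to\mathbb{R}$ be a monotone linkage function, and define $F:\mathcal{F}_{k-1}\to\mathbb{R}$ by $F(X)=\min_{x\in\Gamma(X)}\pi(x,X)$. Define $\pi_F:E\times 2^E\to\mathbb{R}$ by \[ \pi_F(x,X)=\begin{cases}\max_{A\in[X,E-x]_{\mathcal{F}_{k-1}}}F(A), & \text{if } x\notin X \text{ and } [X,E-x]_{\mathcal{F}_{k-1}}\neq\emptyset,\\ \min_{A\in\mathcal{F}_{k-1}}F(A), & \text{otherwise},\end{cases} \] where $[X,E-x]_{\mathcal{F}_{k-1}}=\{A\in\mathcal{F}_{k-1}: X\subseteq A\subseteq E-\{x\}\}$. Then for every $X\in\mathcal{F}_{k-1}$ and every $x\in\Gamma(X)$, \[ \pi_F(x,X)\le\pi(x,X). \]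
   Context: A set system over a finite set $E$ is a pair $(E,\mathcal{F})$ with $\mathcal{F}\subseteq 2^{E}$; members of $\mathcal{F}$ are called feasible. A non-empty set system $(E,\mathcal{A})$ is an antimatroid if (A1) every non-empty $X\in\mathcal{A}$ contains some $x$ with $X-\{x\}\in\mathcal{A}$, and (A2) for all $X,Y\in\mathcal{A}$ with $X\not\subseteq Y$ there is $x\in X-Y$ with $Y\cup\{x\}\in\mathcal{A}$. The rank of a set system is the maximum cardinality of a feasible set. A $k$-truncated antimatroid is a set system $(E,\mathcal{F})$ with $\mathcal{F}=\{X\in\mathcal{A}:|X|\le k\}$ for some antimatroid $(E,\mathcal{A})$; here it is assumed to have rank $k$. For $X\in\mathcal{F}$, $\Gamma(X)=\{x\in E-X: X\cup\{x\}\in\mathcal{F}\}$. A function $\pi:E\times 2^{E}\to\mathbb{R}$ is a monotone linkage function if for all $X\subseteq Y\subseteq E$ and $x\in E$, $\pi(x,X)\ge\pi(x,Y)$. *)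

theory Defs
  imports Complex_Main
begin

definition set_system :: "'a set \<Rightarrow> 'a set set \<Rightarrow> bool" where
  "set_system E \<F> \<longleftrightarrow> finite E \<and> \<F> \<subseteq> Pow E"

definition antimatroid :: "'a set \<Rightarrow> 'a set set \<Rightarrow> bool" where
  "antimatroid E \<A> \<longleftrightarrow>
     set_system E \<A> \<and> \<A> \<noteq> {} \<and>
     (\<forall>X\<in>\<A>. X \<noteq> {} \<longrightarrow> (\<exists>x\<in>X. X - {x} \<in> \<A>)) \<and>
     (\<forall>X\<in>\<A>. \<forall>Y\<in>\<A>. \<not> X \<subseteq> Y \<longrightarrow> (\<exists>x\<in>X - Y. Y \<union> {x} \<in> \<A>))"

definition set_system_rank :: "'a set set \<Rightarrow> nat" where
  "set_system_rank \<F> = Max (card ` \<F>)"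

definition truncated_antimatroid :: "nat \<Rightarrow> 'a set \<Rightarrow> 'a set set \<Rightarrow> bool" where
  "truncated_antimatroid k E \<F> \<longleftrightarrow>
     (\<exists>\<A>. antimatroid E \<A> \<and> \<F> = {X \<in> \<A>. card X \<le> k})"

text \<open>The bound is an integer so that bounding by \<open>k - 1\<close> with \<open>k = 0\<close> gives the empty
  family; truncated subtraction on \<open>nat\<close> would keep the empty set.\<close>

definition feasible_upto :: "'a set set \<Rightarrow> int \<Rightarrow> 'a set set" where
  "feasible_upto \<F> m = {X \<in> \<F>. int (card X) \<le> m}"

definition continuations :: "'a set \<Rightarrow> 'a set set \<Rightarrow> 'a set \<Rightarrow> 'a set" where
  "continuations E \<F> X = {x \<in> E - X. X \<union> {x} \<in> \<F>}"

definition monotone_linkage :: "'a set \<Rightarrow> ('a \<Rightarrow> 'a set \<Rightarrow> real) \<Rightarrow> bool" where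
  "monotone_linkage E \<pi> \<longleftrightarrow>
     (\<forall>X Y x. X \<subseteq> Y \<and> Y \<subseteq> E \<and> x \<in> E \<longrightarrow> \<pi> x X \<ge> \<pi> x Y)"

definition linkage_min ::
  "'a set \<Rightarrow> 'a set set \<Rightarrow> ('a \<Rightarrow> 'a set \<Rightarrow> real) \<Rightarrow> 'a set \<Rightarrow> real" where
  "linkage_min E \<F> \<pi> X = Min ((\<lambda>x. \<pi> x X) ` continuations E \<F> X)"

definition family_interval :: "'a set set \<Rightarrow> 'a set \<Rightarrow> 'a set \<Rightarrow> 'a set set" where
  "family_interval \<G> X Y = {A \<in> \<G>. X \<subseteq> A \<and> A \<subseteq> Y}"

definition induced_linkage ::
  "'a set \<Rightarrow> 'a set set \<Rightarrow> ('a set \<Rightarrow> real) \<Rightarrow> 'a \<Rightarrow> 'a set \<Rightarrow> real" where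
  "induced_linkage E \<G> F x X =
     (if x \<notin> X \<and> family_interval \<G> X (E - {x}) \<noteq> {}
      then Max (F ` family_interval \<G> X (E - {x}))
      else Min (F ` \<G>))"

end

theory Submission
  imports Defs
begin

text \<open>If \<open>x\<close> continues \<open>X\<close> and \<open>A \<supseteq> X\<close> is feasible of size less than \<open>k\<close> and avoids \<open>x\<close>, then
  augmenting \<open>A\<close> from \<open>X \<union> {x}\<close> can only add \<open>x\<close>, so \<open>x\<close> also continues \<open>A\<close>. Hence
  \<open>F(A) \<le> \<pi>(x, A) \<le> \<pi>(x, X)\<close> by monotonicity, for every \<open>A\<close> over which the maximum
  \<open>\<pi>\<^sub>F(x, X)\<close> is taken.\<close>

lemma antimatroid_augment:
  assumes "antimatroid E \<A>" and "X \<in> \<A>" and "Y \<in> \<A>" and "\<not> X \<subseteq> Y"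
  shows "\<exists>x\<in>X - Y. Y \<union> {x} \<in> \<A>"
proof -
  have "\<forall>X\<in>\<A>. \<forall>Y\<in>\<A>. \<not> X \<subseteq> Y \<longrightarrow> (\<exists>x\<in>X - Y. Y \<union> {x} \<in> \<A>)"
    using assms(1) unfolding antimatroid_def by (elim conjE)
  then show ?thesis
    using assms(2-4) by (metis (no_types))
qed

lemma truncated_antimatroid_subset_Pow:
  assumes "truncated_antimatroid k E \<F>"
  shows "\<F> \<subseteq> Pow E"
proof -
  obtain \<A> where "antimatroid E \<A>" and \<F>: "\<F> = {X \<in> \<A>. card X \<le> k}"
    using assms unfolding truncated_antimatroid_def by blast
  then have "\<A> \<subseteq> Pow E"
    unfolding antimatroid_def set_system_def by (elim conjE)
  then show ?thesis
    unfolding \<F> by blast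
qed

text \<open>The exchange property is used in the untruncated antimatroid; the bound
  \<open>int k - 1\<close> on \<open>card A\<close> leaves room for one more element, so the
  enlarged set survives the truncation.\<close>

lemma truncated_antimatroid_continuations_mono:
  assumes "truncated_antimatroid k E \<F>"
    and "x \<in> continuations E \<F> X"
    and "A \<in> feasible_upto \<F> (int k - 1)" and "X \<subseteq> A" and "x \<notin> A"
  shows "x \<in> continuations E \<F> A"
proof -
  obtain \<A> where \<A>: "antimatroid E \<A>" and \<F>: "\<F> = {X \<in> \<A>. card X \<le> k}"
    using assms(1) unfolding truncated_antimatroid_def by blast
  have x: "x \<in> E" "X \<union> {x} \<in> \<A>"
    using assms(2) unfolding continuations_def \<F> by auto
  have A: "A \<in> \<A>" "int (card A) \<le> int k - 1"
    using assms(3) unfolding feasible_upto_def \<F> by auto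
  have "\<not> X \<union> {x} \<subseteq> A"
    using assms(5) by blast
  then obtain y where y: "y \<in> X \<union> {x} - A" "A \<union> {y} \<in> \<A>"
    using antimatroid_augment[OF \<A> x(2) A(1)] by blast
  \<comment> \<open>As \<open>X \<subseteq> A\<close>, the only element that
    \<open>X \<union> {x} - A\<close> can contain is \<open>x\<close>.\<close>
  then have "y = x"
    using assms(4) by blast
  moreover have "card (A \<union> {x}) \<le> k"
    using card_Un_le[of A "{x}"] A(2) by simp
  ultimately show ?thesis
    using x(1) y(2) assms(5) unfolding continuations_def \<F> by simp
qed

lemma linkage_min_le:
  assumes "finite E" and "x \<in> continuations E \<F> A"
  shows "linkage_min E \<F> \<pi> A \<le> \<pi> x A"
proof -
  have "finite (continuations E \<F> A)"
    using assms(1) by (simp add: continuations_def)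
  then show ?thesis
    using assms(2) unfolding linkage_min_def by (intro Min_le) auto
qed

theorem theorem3:
  fixes E :: "'a set" and \<F> :: "'a set set" and k :: nat
    and \<pi> :: "'a \<Rightarrow> 'a set \<Rightarrow> real" and X :: "'a set" and x :: 'a
  assumes "finite E"
    and "truncated_antimatroid k E \<F>"
    and "set_system_rank \<F> = k"
    and "monotone_linkage E \<pi>"
    and "X \<in> feasible_upto \<F> (int k - 1)"
    and "x \<in> continuations E \<F> X"
  shows "induced_linkage E (feasible_upto \<F> (int k - 1)) (linkage_min E \<F> \<pi>) x X \<le> \<pi> x X"
proof -
  let ?I = "family_interval (feasible_upto \<F> (int k - 1)) X (E - {x})"
  have x: "x \<in> E" "x \<notin> X"
    using assms(6) unfolding continuations_def by auto
  have "\<F> \<subseteq> Pow E"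
    using assms(2) by (rule truncated_antimatroid_subset_Pow)
  then have "X \<subseteq> E"
    using assms(5) unfolding feasible_upto_def by blast
  \<comment> \<open>\<open>X\<close> itself is a member, so \<open>induced_linkage\<close> takes its
    \<open>Max\<close> branch and not the default minimum.\<close>
  then have ne: "?I \<noteq> {}"
    using assms(5) x(2) unfolding family_interval_def by blast
  have fin: "finite ?I"
    by (rule finite_subset[of _ "Pow E"]) (use assms(1) in \<open>auto simp: family_interval_def\<close>)
  have "linkage_min E \<F> \<pi> A \<le> \<pi> x X" if "A \<in> ?I" for A
  proof -
    have A: "A \<in> feasible_upto \<F> (int k - 1)" "X \<subseteq> A" "x \<notin> A" "A \<subseteq> E"
      using that unfolding family_interval_def by auto
    \<comment> \<open>Since \<open>x\<close> still continues \<open>A\<close>, the value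
      \<open>\<pi> x A\<close> competes in the minimum at \<open>A\<close>.\<close>
    have "linkage_min E \<F> \<pi> A \<le> \<pi> x A"
      using assms(1) truncated_antimatroid_continuations_mono[OF assms(2,6) A(1,2,3)]
      by (rule linkage_min_le)
    also have "\<dots> \<le> \<pi> x X"
      using assms(4) A(2,4) x(1) unfolding monotone_linkage_def by blast
    finally show ?thesis .
  qed
  \<comment> \<open>For a finite non-empty family, bounding \<open>Max\<close> amounts to bounding
    each value.\<close>
  then have "Max (linkage_min E \<F> \<pi> ` ?I) \<le> \<pi> x X"
    using fin ne by simp
  then show ?thesis
    using ne x(2) unfolding induced_linkage_def by simp
qed

end
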